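(* Let $(\alpha_n)_{n\in\mathbb{N}}$ be a sequence with $0\le\alpha_n\le\frac1n$. Let $g:[0,\infty)\to\mathbb{R}$ be twice differentiable with $g',g''\in C_w^k[0,\infty)$. Then for each $x\ge0$, as $n\to\infty$, $$n\left|\mathcal{U}_{n}^{[\alpha_n]}(g;x)-g(x)-g'(x)\Theta_{n,1}^{[\alpha_n]}(x)-\frac{g''(x)}{2!}\Theta_{n,2}^{[\alpha_n]}(x)\right|=O(1)\,\Delta\left(g'';\sqrt{\tfrac1n}\right);$$ that is, for each $x\ge0$ there are a constant $C$ and an $n_0\in\mathbb{N}$ such that the left-hand side is at most $C\,\Delta\big(g'';\sqrt{1/n}\big)$ for all $n\ge n_0$.
   Context: For $n\in\mathbb{N}$, $0\le\alpha\le\frac1n$, $x\ge 0$ and a function $f$ on $[0,\infty)$ for which the expression converges absolutely, define $$\mathcal{U}_{n}^{[\alpha]}(f;x)=n\sum_{i=0}^{\infty}(1+n\alpha)^{-x/\alpha}\Big(\alpha+\frac1n\Big)^{-i}\frac{x^{(i,-\alpha)}}{i!}\int_0^\infty e^{-nu}\frac{(nu)^i}{i!}f(u)\,du,$$ with $x^{(0,-\alpha)}=1$ and $x^{(i,-\alpha)}=x(x+\alpha)\cdots(x+(i-1)\alpha)$; for $\alpha=0$ the coefficient is understood as its limit as $\alpha\to0$, namely $e^{-nx}\frac{(nx)^i}{i!}$. Central moments: $\Theta_{n,m}^{[\alpha]}(x)=\mathcal{U}_{n}^{[\alpha]}((t-x)^m;x)$, the operator acting on the variable $t$. Let $w(x)=1+x^2$.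 $C_w^k[0,\infty)$ is the set of continuous $f:[0,\infty)\to\mathbb{R}$ with $|f(x)|\le M w(x)$ for all $x\ge 0$ (for some constant $M>0$ depending on $f$) for which $\lim_{x\to\infty}\frac{|f(x)|}{w(x)}$ exists and is finite. For $f\in C_w^k[0,\infty)$ and $\xi>0$, the weighted modulus of continuity is $$\Delta(f;\xi)=\sup_{0\le h\le\xi,\ x\ge0}\frac{|f(x+h)-f(x)|}{(1+h^2)(1+x^2)}.$$ *)

theory Defs
  imports "HOL-Analysis.Analysis"
begin

text \<open>
  Functions on \<open>[0,\<infinity>)\<close> are represented by functions of type \<^typ>\<open>real \<Rightarrow> real\<close>; no
  definition below depends on their values at negative arguments.
\<close>

definition rising_step :: "real \<Rightarrow> nat \<Rightarrow> real \<Rightarrow> real" where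
  "rising_step x i \<alpha> = (\<Prod>j<i. x + real j * \<alpha>)"

text \<open>For \<open>\<alpha> = 0\<close> the general formula has no meaning and is replaced by its limit as \<open>\<alpha> \<rightarrow> 0\<close>.\<close>

definition U_coeff :: "nat \<Rightarrow> real \<Rightarrow> nat \<Rightarrow> real \<Rightarrow> real" where
  "U_coeff n \<alpha> i x =
     (if \<alpha> = 0 then exp (- real n * x) * (real n * x) ^ i / fact i
      else (1 + real n * \<alpha>) powr (- x / \<alpha>) * (\<alpha> + 1 / real n) powi (- int i)
             * (rising_step x i \<alpha> / fact i))"

definition U_op :: "nat \<Rightarrow> real \<Rightarrow> (real \<Rightarrow> real) \<Rightarrow> real \<Rightarrow> real" where
  "U_op n \<alpha> f x =
     real n * (\<Sum>i. U_coeff n \<alpha> i x *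
       (LINT u:{0..}|lborel. exp (- real n * u) * ((real n * u) ^ i / fact i) * f u))"

definition central_moment :: "nat \<Rightarrow> nat \<Rightarrow> real \<Rightarrow> real \<Rightarrow> real" where
  "central_moment n m \<alpha> x = U_op n \<alpha> (\<lambda>t. (t - x) ^ m) x"

definition weight :: "real \<Rightarrow> real" where
  "weight x = 1 + x\<^sup>2"

definition C_w :: "(real \<Rightarrow> real) set" where
  "C_w = {f. continuous_on {0..} f
           \<and> (\<exists>M>0. \<forall>x\<ge>0. \<bar>f x\<bar> \<le> M * weight x)
           \<and> (\<exists>L. ((\<lambda>x. \<bar>f x\<bar> / weight x) \<longlongrightarrow> L) at_top)}"

text \<open>For \<open>f \<in> C_w\<close> the set of quotients is bounded above, so the real supremum is the true one.\<close>

definition weighted_modulus :: "(real \<Rightarrow> real) \<Rightarrow> real \<Rightarrow> real" where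
  "weighted_modulus f \<xi> =
     (SUP (h, x) \<in> {0..\<xi>} \<times> {0..}. \<bar>f (x + h) - f x\<bar> / ((1 + h\<^sup>2) * (1 + x\<^sup>2)))"

end

(* Under the operator the variable u has a generating function in closed form: the gamma kernel
   sends exp (theta u) to a power of z = n / (n - theta), and the weights are Poisson or negative
   binomial. For theta = sqrt n and theta = - sqrt n this bounds the images of
   exp (theta (t - x)) uniformly in n and alpha, which replaces computing central moments.
   Chaining the weighted modulus at the scale 1 / sqrt n bounds the second-order Taylor remainder
   of g by a constant times the modulus times exp (sqrt n |t - x|) / n, and the claim follows by
   positivity. *)
theory Submission
  imports Defs "HOL-Probability.Distributions"
begin

section \<open>The gamma kernel and the domain of the operator\<close>

definition gamma_kernel :: "nat \<Rightarrow> nat \<Rightarrow> real \<Rightarrow> real" where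
  "gamma_kernel n i u = exp (- real n * u) * ((real n * u) ^ i / fact i)"

definition gamma_mean :: "nat \<Rightarrow> nat \<Rightarrow> (real \<Rightarrow> real) \<Rightarrow> real" where
  "gamma_mean n i f = (LINT u:{0..}|lborel. gamma_kernel n i u * f u)"

definition gamma_integrable :: "nat \<Rightarrow> nat \<Rightarrow> (real \<Rightarrow> real) \<Rightarrow> bool" where
  "gamma_integrable n i f \<longleftrightarrow> set_integrable lborel {0..} (\<lambda>u. gamma_kernel n i u * f u)"

text \<open>Integrals and \<open>suminf\<close> are total functions with default values on
  divergence. This predicate records that every integral exists and that the series converges, which
  linearity of \<open>U_op\<close> relies on.\<close>

definition U_dom :: "nat \<Rightarrow> real \<Rightarrow> real \<Rightarrow> (real \<Rightarrow> real) \<Rightarrow> bool" where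
  "U_dom n \<alpha> x f \<longleftrightarrow>
     (\<forall>i. gamma_integrable n i f) \<and> summable (\<lambda>i. U_coeff n \<alpha> i x * gamma_mean n i f)"

lemma U_op_eq: "U_op n \<alpha> f x = real n * (\<Sum>i. U_coeff n \<alpha> i x * gamma_mean n i f)"
  by (simp add: U_op_def gamma_mean_def gamma_kernel_def)

lemma gamma_kernel_nonneg: "u \<ge> 0 \<Longrightarrow> gamma_kernel n i u \<ge> 0"
  by (simp add: gamma_kernel_def)

lemma continuous_on_gamma_kernel: "continuous_on A (gamma_kernel n i)"
  unfolding gamma_kernel_def by (intro continuous_intros) auto

text \<open>Multiplying the kernel by the exponential only changes its rate from \<open>n\<close> to
  \<open>n - \<theta>\<close>: the product is a constant multiple of an Erlang density, whose total
  mass is 1.\<close>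

lemma gamma_mean_exp:
  assumes "\<theta> < real n"
  shows "gamma_integrable n i (\<lambda>u. exp (\<theta> * u))"
    and "gamma_mean n i (\<lambda>u. exp (\<theta> * u)) = real n ^ i / (real n - \<theta>) ^ Suc i"
proof -
  define l where "l = real n - \<theta>"
  have l: "l > 0" using assms by (simp add: l_def)
  interpret prob_space "density lborel (\<lambda>u. ennreal (erlang_density i l u))"
    by (rule prob_space_erlang_density[OF l])
  have nn: "(\<integral>\<^sup>+ u. ennreal (erlang_density i l u) \<partial>lborel) = ennreal 1"
    using emeasure_space_1 by (simp add: emeasure_density)
  have hb: "has_bochner_integral lborel (erlang_density i l) 1"
    using nn l by (intro has_bochner_integral_nn_integral) auto
  have eq: "indicator {0..} u *\<^sub>R (gamma_kernel n i u * exp (\<theta> * u))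
              = real n ^ i / l ^ Suc i * erlang_density i l u" for u
  proof (cases "u < 0")
    case False
    have "exp (- real n * u) * exp (\<theta> * u) = exp (- l * u)"
      unfolding exp_add[symmetric] by (simp add: l_def algebra_simps)
    then show ?thesis
      using False l
      by (simp add: gamma_kernel_def erlang_density_def power_mult_distrib divide_simps mult_ac)
  qed (simp add: erlang_density_def)
  have hb': "has_bochner_integral lborel
      (\<lambda>u. indicator {0..} u *\<^sub>R (gamma_kernel n i u * exp (\<theta> * u))) (real n ^ i / l ^ Suc i)"
    unfolding eq using has_bochner_integral_mult_right[OF hb, of "real n ^ i / l ^ Suc i"] by simp
  show "gamma_integrable n i (\<lambda>u. exp (\<theta> * u))"
    using hb' by (simp add: gamma_integrable_def set_integrable_def has_bochner_integral_iff)
  show "gamma_mean n i (\<lambda>u. exp (\<theta> * u)) = real n ^ i / (real n - \<theta>) ^ Suc i"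
    using hb' unfolding gamma_mean_def set_lebesgue_integral_def
    by (simp add: has_bochner_integral_iff l_def)
qed

section \<open>The weights and their generating function\<close>

lemma U_coeff_nonneg:
  assumes "\<alpha> \<ge> 0" "x \<ge> 0"
  shows "U_coeff n \<alpha> i x \<ge> 0"
  using assms by (auto simp: U_coeff_def rising_step_def intro!: mult_nonneg_nonneg divide_nonneg_nonneg prod_nonneg)

lemma rising_step_eq_pochhammer:
  assumes "\<alpha> \<noteq> 0"
  shows "rising_step x i \<alpha> = \<alpha> ^ i * pochhammer (x / \<alpha>) i"
proof -
  have "rising_step x i \<alpha> = (\<Prod>j<i. \<alpha> * (x / \<alpha> + real j))"
    using assms by (simp add: rising_step_def algebra_simps)
  also have "\<dots> = \<alpha> ^ i * pochhammer (x / \<alpha>) i"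
    by (simp add: prod.distrib pochhammer_prod atLeast0LessThan)
  finally show ?thesis .
qed

text \<open>For \<open>\<alpha> = 0\<close> this is the exponential series of a Poisson law.
  Otherwise it is the binomial series with exponent \<open>- x / \<alpha>\<close> at
  \<open>- (q * z)\<close>, where \<open>q = c / (1 + c)\<close> and
  \<open>c = n * \<alpha>\<close>. Since \<open>c \<le> 1\<close>, we have
  \<open>q \<le> 1 / 2\<close>, so the series converges for all
  \<open>\<bar>z\<bar> < 2\<close>.\<close>

lemma U_coeff_pgf:
  assumes n: "n \<ge> 1" and \<alpha>: "0 \<le> \<alpha>" "\<alpha> \<le> 1 / real n" and z: "\<bar>z\<bar> < 2"
  shows "(\<lambda>i. U_coeff n \<alpha> i x * z ^ i) sums
           (if \<alpha> = 0 then exp (real n * x * (z - 1))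
            else (1 - real n * \<alpha> * (z - 1)) powr (- x / \<alpha>))"
proof (cases "\<alpha> = 0")
  case True
  have "(\<lambda>i. exp (- real n * x) * ((real n * x * z) ^ i /\<^sub>R fact i)) sums
          (exp (- real n * x) * exp (real n * x * z))"
    by (intro sums_mult exp_converges)
  moreover have "exp (- real n * x) * exp (real n * x * z) = exp (real n * x * (z - 1))"
    unfolding exp_add[symmetric] by (simp add: algebra_simps)
  moreover have "exp (- real n * x) * ((real n * x * z) ^ i /\<^sub>R fact i) = U_coeff n \<alpha> i x * z ^ i" for i
    using True by (simp add: U_coeff_def power_mult_distrib divide_simps)
  ultimately show ?thesis using True by simp
next
  case False
  define c where "c = real n * \<alpha>"
  define q where "q = c / (1 + c)"
  have c: "0 < c" "c \<le> 1"
    using False \<alpha> n by (auto simp: c_def field_simps)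
  have q: "0 < q" "q \<le> 1 / 2" using c by (auto simp: q_def field_simps)
  have "\<bar>q * z\<bar> \<le> 1 / 2 * \<bar>z\<bar>"
    unfolding abs_mult using q by (intro mult_right_mono) auto
  then have qz: "\<bar>- (q * z)\<bar> < 1" using z by simp
  have "(\<lambda>i. (1 + c) powr (- x / \<alpha>) * ((- x / \<alpha> gchoose i) * (- (q * z)) ^ i)) sums
          ((1 + c) powr (- x / \<alpha>) * (1 + - (q * z)) powr (- x / \<alpha>))"
    by (intro sums_mult gen_binomial_real qz)
  moreover have "(1 + c) powr (- x / \<alpha>) * (1 + - (q * z)) powr (- x / \<alpha>)
                   = (1 - c * (z - 1)) powr (- x / \<alpha>)"
  proof -
    have "(1 + c) * (1 + - (q * z)) = 1 - c * (z - 1)"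
      using c by (simp add: q_def field_simps)
    then show ?thesis
      using c qz by (subst powr_mult[symmetric]) auto
  qed
  moreover have "(1 + c) powr (- x / \<alpha>) * ((- x / \<alpha> gchoose i) * (- (q * z)) ^ i)
                   = U_coeff n \<alpha> i x * z ^ i" for i
  proof -
    have qa: "q = \<alpha> / (\<alpha> + 1 / real n)"
      using n c by (simp add: q_def c_def field_simps)
    \<comment> \<open>The sign from passing to the Pochhammer symbol cancels the sign of
      \<open>- (q * z)\<close>; the powers of \<open>\<alpha>\<close> inside \<open>q ^ i\<close>
      restore \<open>rising_step\<close>.\<close>
    have "(- x / \<alpha> gchoose i) * (- (q * z)) ^ i
            = pochhammer (x / \<alpha>) i / fact i * ((-1) ^ i * (- (q * z)) ^ i)"
      by (simp add: gbinomial_pochhammer)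
    also have "(-1) ^ i * (- (q * z)) ^ i = q ^ i * z ^ i"
      by (simp add: power_mult_distrib[symmetric])
    also have "q ^ i = (\<alpha> + 1 / real n) powi (- int i) * \<alpha> ^ i"
      by (simp add: qa power_divide power_int_minus divide_inverse power_mult_distrib power_inverse)
    finally show ?thesis
      using False
      by (simp add: U_coeff_def c_def rising_step_eq_pochhammer)
  qed
  ultimately show ?thesis using False by (simp add: c_def)
qed

lemma U_coeff_sums_1:
  assumes "n \<ge> 1" "0 \<le> \<alpha>" "\<alpha> \<le> 1 / real n"
  shows "(\<lambda>i. U_coeff n \<alpha> i x) sums 1"
  using U_coeff_pgf[OF assms, of 1 x] by (simp split: if_splits)

text \<open>The logarithm of the generating function is expanded to second order by
  \<open>- ln (1 - y) \<le> y + 2 * y\<^sup>2\<close> for \<open>\<bar>y\<bar> \<le> 1 / 2\<close>,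
  with \<open>y = n * \<alpha> * (z - 1)\<close>. The resulting bound is free of
  \<open>\<alpha>\<close>.\<close>

lemma U_coeff_pgf_bound:
  assumes n: "n \<ge> 1" and \<alpha>: "0 \<le> \<alpha>" "\<alpha> \<le> 1 / real n" and z: "\<bar>z - 1\<bar> \<le> 1 / 2" and x: "x \<ge> 0"
  shows "summable (\<lambda>i. U_coeff n \<alpha> i x * z ^ i)"
    and "(\<Sum>i. U_coeff n \<alpha> i x * z ^ i) \<le> exp (real n * x * ((z - 1) + 2 * (z - 1)\<^sup>2))"
proof -
  have z2: "\<bar>z\<bar> < 2" using z by linarith
  note s = U_coeff_pgf[OF n \<alpha> z2, of x]
  show "summable (\<lambda>i. U_coeff n \<alpha> i x * z ^ i)" using s by (rule sums_summable)
  show "(\<Sum>i. U_coeff n \<alpha> i x * z ^ i) \<le> exp (real n * x * ((z - 1) + 2 * (z - 1)\<^sup>2))"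
  proof (cases "\<alpha> = 0")
    case True
    then have "(\<Sum>i. U_coeff n \<alpha> i x * z ^ i) = exp (real n * x * (z - 1))"
      using sums_unique[OF s] by simp
    with x show ?thesis by (simp add: mult_left_mono)
  next
    case False
    define c where "c = real n * \<alpha>"
    have c: "0 < c" "c \<le> 1" using False \<alpha> n by (auto simp: c_def field_simps)
    define y where "y = c * (z - 1)"
    have y: "\<bar>y\<bar> \<le> 1 / 2"
      using mult_mono[of c 1 "\<bar>z - 1\<bar>" "1/2"] c z by (simp add: y_def abs_mult)
    have "\<bar>ln (1 + - y) - (- y)\<bar> \<le> 2 * (- y)\<^sup>2"
      using y by (intro abs_ln_one_plus_x_minus_x_bound) auto
    then have "- ln (1 - y) \<le> y + 2 * y\<^sup>2" by auto
    \<comment> \<open>Lowering \<open>c\<^sup>2\<close> to \<open>c\<close> leaves a single factor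
      \<open>c = n * \<alpha>\<close>, which cancels the \<open>\<alpha>\<close> in
      \<open>x / \<alpha>\<close>.\<close>
    also have "\<dots> \<le> c * ((z - 1) + 2 * (z - 1)\<^sup>2)"
    proof -
      have "c\<^sup>2 \<le> c" using c by (simp add: power2_eq_square)
      then have "c\<^sup>2 * (z - 1)\<^sup>2 \<le> c * (z - 1)\<^sup>2" by (intro mult_right_mono) auto
      then show ?thesis by (simp add: y_def power_mult_distrib distrib_left mult.left_commute)
    qed
    finally have "x / \<alpha> * (- ln (1 - y)) \<le> x / \<alpha> * (c * ((z - 1) + 2 * (z - 1)\<^sup>2))"
      using x \<alpha> by (intro mult_left_mono) auto
    also have "\<dots> = real n * x * ((z - 1) + 2 * (z - 1)\<^sup>2)"
      using False by (simp add: c_def)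
    finally have "(1 - y) powr (- x / \<alpha>) \<le> exp (real n * x * ((z - 1) + 2 * (z - 1)\<^sup>2))"
      using y by (simp add: powr_def)
    with False show ?thesis by (simp add: sums_unique[OF s, symmetric] y_def c_def)
  qed
qed

section \<open>Linearity and positivity of the operator\<close>

lemma U_dom_add:
  assumes "U_dom n \<alpha> x f" "U_dom n \<alpha> x h"
  shows "U_dom n \<alpha> x (\<lambda>t. f t + h t)"
    and "U_op n \<alpha> (\<lambda>t. f t + h t) x = U_op n \<alpha> f x + U_op n \<alpha> h x"
proof -
  have i: "gamma_integrable n i f" "gamma_integrable n i h" for i
    using assms by (auto simp: U_dom_def)
  have e: "gamma_mean n i (\<lambda>t. f t + h t) = gamma_mean n i f + gamma_mean n i h" for i
    using i unfolding gamma_mean_def gamma_integrable_def by (simp add: distrib_left)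
  have "gamma_integrable n i (\<lambda>t. f t + h t)" for i
    using i unfolding gamma_integrable_def by (simp add: distrib_left)
  then show "U_dom n \<alpha> x (\<lambda>t. f t + h t)"
    using assms by (auto simp: U_dom_def e distrib_left intro!: summable_add)
  show "U_op n \<alpha> (\<lambda>t. f t + h t) x = U_op n \<alpha> f x + U_op n \<alpha> h x"
    using assms by (simp add: U_dom_def U_op_eq e distrib_left flip: suminf_add)
qed

lemma U_dom_cmult:
  assumes "U_dom n \<alpha> x f"
  shows "U_dom n \<alpha> x (\<lambda>t. c * f t)"
    and "U_op n \<alpha> (\<lambda>t. c * f t) x = c * U_op n \<alpha> f x"
proof -
  have i: "gamma_integrable n i f" for i
    using assms by (auto simp: U_dom_def)
  \<comment> \<open>With \<open>c\<close> fixed, unfolding this equation pulls the scalar out past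
    the kernel and past the weights.\<close>
  have c: "a * (c * b) = c * (a * b)" for a b :: real by simp
  have e: "gamma_mean n i (\<lambda>t. c * f t) = c * gamma_mean n i f" for i
    unfolding gamma_mean_def c by simp
  have "gamma_integrable n i (\<lambda>t. c * f t)" for i
    using i unfolding gamma_integrable_def c by simp
  then show "U_dom n \<alpha> x (\<lambda>t. c * f t)"
    using assms unfolding U_dom_def e c by (auto intro!: summable_mult)
  show "U_op n \<alpha> (\<lambda>t. c * f t) x = c * U_op n \<alpha> f x"
    using assms unfolding U_dom_def U_op_eq e c by (simp add: suminf_mult)
qed

text \<open>Kernel and weights are nonnegative, so domination passes first through each integral and
  then through the series by comparison. Continuity supplies the measurability of the
  integrand.\<close>

lemma U_dom_dominated:
  assumes \<alpha>: "\<alpha> \<ge> 0" and x: "x \<ge> 0" and G: "U_dom n \<alpha> x G"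
    and f: "continuous_on {0..} f" and le: "\<And>t. t \<ge> 0 \<Longrightarrow> \<bar>f t\<bar> \<le> G t"
  shows "U_dom n \<alpha> x f" and "\<bar>U_op n \<alpha> f x\<bar> \<le> U_op n \<alpha> G x"
proof -
  have iG: "set_integrable lborel {0..} (\<lambda>u. gamma_kernel n i u * G u)" for i
    using G by (auto simp: U_dom_def gamma_integrable_def)
  have bd: "\<bar>gamma_kernel n i u * f u\<bar> \<le> gamma_kernel n i u * G u" if "u \<ge> 0" for i u
    using le[OF that] gamma_kernel_nonneg[OF that, of n i]
    by (simp add: abs_mult mult_left_mono)
  have i: "set_integrable lborel {0..} (\<lambda>u. gamma_kernel n i u * f u)" for i
  proof (rule set_integrable_bound[OF iG[of i]])
    have "(\<lambda>u. indicator {0..} u *\<^sub>R (gamma_kernel n i u * f u)) \<in> borel_measurable borel"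
      by (intro borel_measurable_continuous_on_indicator continuous_on_mult
            continuous_on_gamma_kernel f) auto
    then show "set_borel_measurable lborel {0..} (\<lambda>u. gamma_kernel n i u * f u)"
      by (simp add: set_borel_measurable_def)
    show "AE u in lborel. u \<in> {0..} \<longrightarrow>
        norm (gamma_kernel n i u * f u) \<le> norm (gamma_kernel n i u * G u)"
      using bd by (intro AE_I2) (auto intro: order_trans[OF _ abs_ge_self])
  qed
  have m: "\<bar>gamma_mean n i f\<bar> \<le> gamma_mean n i G" for i
  proof -
    have "gamma_mean n i f \<le> gamma_mean n i G"
      unfolding gamma_mean_def using bd by (intro set_integral_mono i iG) (auto dest: abs_le_D1)
    \<comment> \<open>Monotonicity of the integral is one-sided; the lower bound comes from the
      negated integrand.\<close>
    moreover have "- gamma_mean n i f = (LINT u:{0..}|lborel. - (gamma_kernel n i u * f u))"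
      using i[of i] by (simp add: gamma_mean_def set_integral_uminus)
    then have "- gamma_mean n i f \<le> gamma_mean n i G"
      using bd i[of i] iG[of i] unfolding gamma_mean_def
      by (auto intro!: set_integral_mono simp: set_integrable_def dest: abs_le_D2)
    ultimately show ?thesis by linarith
  qed
  have cm: "norm (U_coeff n \<alpha> i x * gamma_mean n i f) \<le> U_coeff n \<alpha> i x * gamma_mean n i G" for i
    using m[of i] U_coeff_nonneg[OF \<alpha> x, of n i] by (simp add: abs_mult mult_left_mono)
  have sG: "summable (\<lambda>i. U_coeff n \<alpha> i x * gamma_mean n i G)"
    using G by (simp add: U_dom_def)
  have "summable (\<lambda>i. U_coeff n \<alpha> i x * gamma_mean n i f)"
    by (rule summable_comparison_test[OF _ sG]) (use cm in auto)
  then show "U_dom n \<alpha> x f" using i by (simp add: U_dom_def gamma_integrable_def)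
  have "\<bar>\<Sum>i. U_coeff n \<alpha> i x * gamma_mean n i f\<bar> \<le> (\<Sum>i. U_coeff n \<alpha> i x * gamma_mean n i G)"
    using norm_suminf_le[OF cm sG] by simp
  then show "\<bar>U_op n \<alpha> f x\<bar> \<le> U_op n \<alpha> G x"
    by (simp add: U_op_eq abs_mult mult_left_mono)
qed

section \<open>Exponential test functions\<close>

text \<open>The factor \<open>real n\<close> normalises each gamma kernel to a probability density,
  and the weights sum to 1.\<close>

lemma U_op_1:
  assumes "n \<ge> 1" "0 \<le> \<alpha>" "\<alpha> \<le> 1 / real n"
  shows "U_op n \<alpha> (\<lambda>_. 1) x = 1"
proof -
  have "gamma_mean n i (\<lambda>_. 1) = 1 / real n" for i
    using gamma_mean_exp(2)[of 0 n i] assms(1) by simp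
  moreover have "(\<Sum>i. U_coeff n \<alpha> i x / real n) = 1 / real n"
    by (rule sums_unique[symmetric, OF sums_divide[OF U_coeff_sums_1[OF assms]]])
  ultimately show ?thesis
    using assms(1) by (simp add: U_op_eq)
qed

text \<open>The image of \<open>exp (\<theta> * t)\<close> is \<open>z\<close> times the generating
  function at \<open>z = n / (n - \<theta>)\<close>. In the exponent the first-order term
  \<open>n * (z - 1)\<close> cancels the shift \<open>- \<theta>\<close> up to \<open>n / d\<close>,
  where \<open>d = n - \<theta>\<close>; at the scale \<open>\<theta>\<^sup>2 = n\<close> what
  remains is bounded. Fixing only the square of \<open>\<theta>\<close> covers both signs.\<close>

lemma U_op_exp_bound:
  assumes n: "n \<ge> 16" and \<alpha>: "0 \<le> \<alpha>" "\<alpha> \<le> 1 / real n" and x: "x \<ge> 0" and \<theta>: "\<theta>\<^sup>2 = real n"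
  shows "U_dom n \<alpha> x (\<lambda>t. exp (\<theta> * (t - x)))"
    and "U_op n \<alpha> (\<lambda>t. exp (\<theta> * (t - x))) x \<le> 2 * exp (5 * x)"
proof -
  define z where "z = real n / (real n - \<theta>)"
  \<comment> \<open>This is where 16 comes from: it keeps \<open>d\<close> above
    \<open>3 / 4 * n\<close>, hence \<open>\<bar>z - 1\<bar>\<close> below 1/2.\<close>
  have th: "\<bar>\<theta>\<bar> \<le> real n / 4"
  proof (rule power2_le_imp_le)
    have "16 * real n \<le> real n * real n" using n by (intro mult_right_mono) auto
    then show "\<bar>\<theta>\<bar>\<^sup>2 \<le> (real n / 4)\<^sup>2"
      using \<theta> by (simp add: power2_eq_square field_simps)
  qed simp
  define d where "d = real n - \<theta>"
  have d: "d \<ge> 3 / 4 * real n" "d > 0" using th n by (auto simp: d_def)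
  have z1: "z - 1 = \<theta> / d" using d by (simp add: z_def d_def[symmetric]) (simp add: d_def field_simps)
  have zb: "\<bar>z - 1\<bar> \<le> 1 / 2" using d th by (simp add: z1 field_simps)
  have n1: "n \<ge> 1" using n by simp
  note pg = U_coeff_pgf_bound[OF n1 \<alpha> zb x]
  have e: "exp (\<theta> * (t - x)) = exp (- \<theta> * x) * exp (\<theta> * t)" for t
    unfolding exp_add[symmetric] by (simp add: algebra_simps)
  have gm: "gamma_mean n i (\<lambda>u. exp (\<theta> * u)) = z ^ i / d" for i
    using gamma_mean_exp(2)[of \<theta> n i] d by (simp add: z_def d_def power_divide)
  have gi: "gamma_integrable n i (\<lambda>u. exp (\<theta> * u))" for i
    using gamma_mean_exp(1)[of \<theta> n i] d by (simp add: d_def)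
  have dom: "U_dom n \<alpha> x (\<lambda>t. exp (\<theta> * t))"
    using gi summable_divide[OF pg(1), of d] by (simp add: U_dom_def gm)
  show "U_dom n \<alpha> x (\<lambda>t. exp (\<theta> * (t - x)))"
    unfolding e by (rule U_dom_cmult(1)[OF dom])
  have "U_op n \<alpha> (\<lambda>t. exp (\<theta> * t)) x = z * (\<Sum>i. U_coeff n \<alpha> i x * z ^ i)"
    using suminf_divide[OF pg(1), of d] by (simp add: U_op_eq gm z_def d_def)
  also have "\<dots> \<le> 2 * exp (real n * x * ((z - 1) + 2 * (z - 1)\<^sup>2))"
  proof (rule mult_mono)
    show "z \<le> 2" using zb by linarith
    have "0 \<le> z" using zb by linarith
    then show "0 \<le> (\<Sum>i. U_coeff n \<alpha> i x * z ^ i)"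
      by (intro suminf_nonneg pg(1) mult_nonneg_nonneg U_coeff_nonneg \<alpha> x) auto
  qed (use pg(2) in auto)
  finally have "U_op n \<alpha> (\<lambda>t. exp (\<theta> * (t - x))) x
      \<le> exp (- \<theta> * x) * (2 * exp (real n * x * ((z - 1) + 2 * (z - 1)\<^sup>2)))"
    unfolding e U_dom_cmult(2)[OF dom] by (intro mult_left_mono) auto
  also have "\<dots> = 2 * exp (x * (real n * (z - 1) - \<theta> + 2 * (real n * (z - 1)\<^sup>2)))"
    by (simp add: exp_add[symmetric] algebra_simps flip: exp_add)
  also have "\<dots> \<le> 2 * exp (5 * x)"
  proof -
    have "real n * (z - 1) - \<theta> = real n / d"
      using d \<theta> by (simp add: z1 field_simps) (simp add: d_def power2_eq_square algebra_simps)
    moreover have "real n * (z - 1)\<^sup>2 = (real n / d)\<^sup>2"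
      using \<theta> by (simp add: z1 power_divide power2_eq_square)
    moreover have nd: "real n / d \<le> 4 / 3" using d by (simp add: field_simps)
    moreover have "(real n / d)\<^sup>2 \<le> (4 / 3)\<^sup>2" using nd d by (intro power_mono) auto
    \<comment> \<open>The value is at most 4/3 + 2 * 16/9 = 44/9.\<close>
    ultimately have "real n * (z - 1) - \<theta> + 2 * (real n * (z - 1)\<^sup>2) \<le> 5"
      by (simp add: power2_eq_square)
    from mult_left_mono[OF this x] show ?thesis by (simp add: mult_ac)
  qed
  finally show "U_op n \<alpha> (\<lambda>t. exp (\<theta> * (t - x))) x \<le> 2 * exp (5 * x)" .
qed

section \<open>The weighted modulus of continuity\<close>

text \<open>A real supremum bounds its members only if the set is bounded above. The quadratic
  growth of \<open>f\<close> bounds all quotients by \<open>4 * M\<close>, independently of the step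
  and of the base point.\<close>

lemma weighted_modulus_upper:
  assumes f: "f \<in> C_w" and "0 \<le> h" "h \<le> \<xi>" "0 \<le> x"
  shows "\<bar>f (x + h) - f x\<bar> \<le> (1 + h\<^sup>2) * (1 + x\<^sup>2) * weighted_modulus f \<xi>"
proof -
  obtain M where M: "M > 0" "\<And>y. y \<ge> 0 \<Longrightarrow> \<bar>f y\<bar> \<le> M * (1 + y\<^sup>2)"
    using f by (auto simp: C_w_def weight_def)
  let ?q = "\<lambda>(h, x). \<bar>f (x + h) - f x\<bar> / ((1 + h\<^sup>2) * (1 + x\<^sup>2))"
  have pos: "0 < (1 + h\<^sup>2) * (1 + y\<^sup>2)" for h y :: real
    by (intro mult_pos_pos add_pos_nonneg) auto
  have "bdd_above (?q ` ({0..\<xi>} \<times> {0..}))"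
  proof (rule bdd_aboveI2[where M = "4 * M"])
    fix p assume "p \<in> {0..\<xi>} \<times> {0::real..}"
    then obtain h y where p: "p = (h, y)" and hy: "h \<ge> 0" "y \<ge> 0" by auto
    have "\<bar>f (y + h) - f y\<bar> \<le> M * (1 + (y + h)\<^sup>2) + M * (1 + y\<^sup>2)"
      using M(2)[of y] M(2)[of "y + h"] hy by auto
    also have "\<dots> = M * (2 + (y + h)\<^sup>2 + y\<^sup>2)" by (simp add: algebra_simps)
    also have "\<dots> \<le> M * (4 * ((1 + h\<^sup>2) * (1 + y\<^sup>2)))"
    proof (intro mult_left_mono)
      have "(y + h)\<^sup>2 \<le> 2 * y\<^sup>2 + 2 * h\<^sup>2"
        using zero_le_power2[of "y - h"] by (simp add: power2_eq_square algebra_simps)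
      moreover have "0 \<le> h\<^sup>2 * y\<^sup>2" by simp
      ultimately show "2 + (y + h)\<^sup>2 + y\<^sup>2 \<le> 4 * ((1 + h\<^sup>2) * (1 + y\<^sup>2))"
        unfolding distrib_left distrib_right
        using zero_le_power2[of h] zero_le_power2[of y] by linarith
    qed (use M in auto)
    finally show "?q p \<le> 4 * M"
      using pos[of h y] by (simp add: p divide_le_eq mult_ac)
  qed
  then have "?q (h, x) \<le> weighted_modulus f \<xi>"
    unfolding weighted_modulus_def by (intro cSUP_upper) (use assms in auto)
  then show ?thesis
    using pos[of h x] by (simp add: divide_le_eq mult_ac)
qed

lemma weighted_modulus_nonneg: "f \<in> C_w \<Longrightarrow> \<xi> \<ge> 0 \<Longrightarrow> weighted_modulus f \<xi> \<ge> 0"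
  using weighted_modulus_upper[of f 0 \<xi> 0] by simp

text \<open>The interval is cut into \<open>k\<close> equal steps of length at most
  \<open>\<delta>\<close>. All nodes lie in \<open>{0..m}\<close>, so each step costs at most the
  same amount, and \<open>k \<le> 1 + (b - a) / \<delta>\<close>.\<close>

lemma weighted_modulus_chain:
  assumes f: "f \<in> C_w" and \<delta>: "\<delta> > 0" and ab: "0 \<le> a" "a \<le> b" "b \<le> m"
  shows "\<bar>f b - f a\<bar> \<le> (1 + (b - a) / \<delta>) * ((1 + \<delta>\<^sup>2) * (1 + m\<^sup>2) * weighted_modulus f \<delta>)"
proof -
  define K where "K = (1 + \<delta>\<^sup>2) * (1 + m\<^sup>2) * weighted_modulus f \<delta>"
  have W: "weighted_modulus f \<delta> \<ge> 0" using weighted_modulus_nonneg f \<delta> by simp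
  then have K: "K \<ge> 0" unfolding K_def by (intro mult_nonneg_nonneg) auto
  \<comment> \<open>Adding 1 to the floor keeps \<open>k\<close> positive even for
    \<open>a = b\<close>, and makes the step no longer than \<open>\<delta>\<close>.\<close>
  define k where "k = nat \<lfloor>(b - a) / \<delta>\<rfloor> + 1"
  have k: "real k \<le> 1 + (b - a) / \<delta>" "(b - a) / \<delta> \<le> real k" "k > 0"
    using ab \<delta> by (auto simp: k_def) linarith+
  define h where "h = (b - a) / real k"
  have h: "0 \<le> h" "h \<le> \<delta>" "a + real k * h = b"
    using k ab \<delta> by (auto simp: h_def field_simps)
  have "\<bar>f (a + real j * h) - f a\<bar> \<le> real j * K" if "j \<le> k" for j
    using that
  proof (induction j)
    case (Suc j)
    have "a + real j * h \<le> a + real k * h"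
      using Suc.prems h by (intro add_left_mono mult_right_mono) auto
    then have y: "0 \<le> a + real j * h" "a + real j * h \<le> m" using ab h by auto
    have "\<bar>f (a + real j * h + h) - f (a + real j * h)\<bar>
            \<le> (1 + h\<^sup>2) * (1 + (a + real j * h)\<^sup>2) * weighted_modulus f \<delta>"
      by (rule weighted_modulus_upper[OF f h(1,2) y(1)])
    also have "\<dots> \<le> K"
      unfolding K_def using h y W by (intro mult_right_mono mult_mono add_left_mono power_mono) auto
    finally show ?case using Suc by (simp add: algebra_simps)
  qed simp
  from this[of k] have "\<bar>f b - f a\<bar> \<le> real k * K" using h by simp
  also have "\<dots> \<le> (1 + (b - a) / \<delta>) * K" using k K by (intro mult_right_mono) auto
  finally show ?thesis by (simp add: K_def)
qed

text \<open>Chaining runs from the smaller point to the larger one, and \<open>x + s\<close> lies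
  above both. The bound depends on \<open>y\<close> only through \<open>s\<close>, as a uniform
  bound in Taylor's formula requires.\<close>

lemma weighted_modulus_bound:
  assumes f: "f \<in> C_w" and \<delta>: "\<delta> > 0" and ab: "0 \<le> x" "0 \<le> y" and s: "\<bar>y - x\<bar> \<le> s"
  shows "\<bar>f y - f x\<bar> \<le> (1 + s / \<delta>) * ((1 + \<delta>\<^sup>2) * (1 + (x + s)\<^sup>2) * weighted_modulus f \<delta>)"
proof -
  let ?K = "(1 + \<delta>\<^sup>2) * (1 + (x + s)\<^sup>2) * weighted_modulus f \<delta>"
  have W: "weighted_modulus f \<delta> \<ge> 0" using weighted_modulus_nonneg f \<delta> by simp
  have "\<bar>f y - f x\<bar> \<le> (1 + \<bar>y - x\<bar> / \<delta>) * ?K"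
  proof (cases "x \<le> y")
    case True
    then show ?thesis using weighted_modulus_chain[OF f \<delta> ab(1) True, of "x + s"] s by simp
  next
    case False
    then show ?thesis using weighted_modulus_chain[OF f \<delta> ab(2), of x "x + s"] s
      by (simp add: abs_minus_commute)
  qed
  also have "\<dots> \<le> (1 + s / \<delta>) * ?K"
    using W \<delta> s by (intro mult_right_mono add_left_mono divide_right_mono) auto
  finally show ?thesis .
qed

section \<open>The second-order Taylor remainder\<close>

text \<open>The mean value inequality is applied twice on the segment from \<open>x\<close> to
  \<open>t\<close>: first to \<open>g'\<close> minus its linear part, then to \<open>g\<close> minus
  its quadratic Taylor polynomial. Each application contributes one factor
  \<open>\<bar>t - x\<bar>\<close>.\<close>

lemma taylor2_remainder_bound:
  fixes g g' g'' :: "real \<Rightarrow> real"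
  assumes S: "convex S" "x \<in> S" "t \<in> S"
    and g: "\<And>y. y \<in> S \<Longrightarrow> (g has_real_derivative g' y) (at y within S)"
    and g': "\<And>y. y \<in> S \<Longrightarrow> (g' has_real_derivative g'' y) (at y within S)"
    and B: "\<And>y. y \<in> S \<Longrightarrow> \<bar>y - x\<bar> \<le> \<bar>t - x\<bar> \<Longrightarrow> \<bar>g'' y - g'' x\<bar> \<le> B"
  shows "\<bar>g t - g x - g' x * (t - x) - g'' x / 2 * (t - x)\<^sup>2\<bar> \<le> B * (t - x)\<^sup>2"
proof -
  let ?T = "closed_segment x t"
  have TS: "?T \<subseteq> S" using S by (simp add: closed_segment_subset)
  have T: "y \<in> S" "\<bar>y - x\<bar> \<le> \<bar>t - x\<bar>" if "y \<in> ?T" for y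
    using that TS by (auto simp: closed_segment_eq_real_ivl split: if_splits)
  have xT: "x \<in> ?T" "t \<in> ?T" by auto
  have B0: "B \<ge> 0" using B[of x] S by auto
  have 1: "\<bar>g' y - g'' x * y - (g' x - g'' x * x)\<bar> \<le> B * \<bar>t - x\<bar>" if y: "y \<in> ?T" for y
  proof -
    have "norm ((g' y - g'' x * y) - (g' x - g'' x * x)) \<le> B * norm (y - x)"
    proof (rule field_differentiable_bound[where S = ?T and f' = "\<lambda>y. g'' y - g'' x"])
      fix z assume z: "z \<in> ?T"
      show "((\<lambda>y. g' y - g'' x * y) has_field_derivative g'' z - g'' x) (at z within ?T)"
        using DERIV_subset[OF g'[OF T(1)[OF z]] TS] by (auto intro!: derivative_eq_intros)
      show "norm (g'' z - g'' x) \<le> B" using B T[OF z] by simp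
    qed (use y in auto)
    also have "\<dots> \<le> B * \<bar>t - x\<bar>" using T[OF y] B0 by (simp add: mult_left_mono)
    finally show ?thesis by simp
  qed
  let ?h = "\<lambda>y. g y - g' x * (y - x) - g'' x / 2 * (y - x)\<^sup>2"
  have "norm (?h t - ?h x) \<le> B * \<bar>t - x\<bar> * norm (t - x)"
  proof (rule field_differentiable_bound[where S = ?T
        and f' = "\<lambda>y. g' y - g'' x * y - (g' x - g'' x * x)"])
    fix z assume z: "z \<in> ?T"
    show "(?h has_field_derivative g' z - g'' x * z - (g' x - g'' x * x)) (at z within ?T)"
      using DERIV_subset[OF g[OF T(1)[OF z]] TS]
      by (auto intro!: derivative_eq_intros simp: field_simps)
    show "norm (g' z - g'' x * z - (g' x - g'' x * x)) \<le> B * \<bar>t - x\<bar>" using 1[OF z] by simp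
  qed auto
  then show ?thesis by (simp add: power2_eq_square algebra_simps)
qed

text \<open>In the variable \<open>v = sqrt n * \<bar>t - x\<bar>\<close> the chained modulus and
  the factor \<open>(t - x)\<^sup>2 = v\<^sup>2 / n\<close> give a polynomial of degree 5 in
  \<open>v\<close>, divided by \<open>n\<close>. The exponential absorbs the polynomial.\<close>

lemma taylor2_remainder_exp_bound:
  fixes g g' g'' :: "real \<Rightarrow> real"
  assumes g: "\<And>t. t \<ge> 0 \<Longrightarrow> (g has_real_derivative g' t) (at t within {0..})"
    and g': "\<And>t. t \<ge> 0 \<Longrightarrow> (g' has_real_derivative g'' t) (at t within {0..})"
    and f: "g'' \<in> C_w" and n: "n \<ge> 1" and x: "x \<ge> 0" and t: "t \<ge> 0"
  shows "\<bar>g t - g x - g' x * (t - x) - g'' x / 2 * (t - x)\<^sup>2\<bar>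
     \<le> 12500 * (1 + x\<^sup>2) * weighted_modulus g'' (sqrt (1 / real n)) / real n
         * exp (sqrt (real n) * \<bar>t - x\<bar>)"
proof -
  define \<delta> where "\<delta> = sqrt (1 / real n)"
  define s where "s = \<bar>t - x\<bar>"
  define v where "v = sqrt (real n) * s"
  define W where "W = weighted_modulus g'' \<delta>"
  have \<delta>: "\<delta> > 0" "\<delta>\<^sup>2 = 1 / real n" "\<delta>\<^sup>2 \<le> 1" using n by (auto simp: \<delta>_def)
  have W: "W \<ge> 0" using weighted_modulus_nonneg f \<delta> by (simp add: W_def)
  have s0: "s \<ge> 0" by (simp add: s_def)
  have v: "s / \<delta> = v" "s \<le> v" "s\<^sup>2 = v\<^sup>2 / real n" "v \<ge> 0"
    using n s0 mult_right_mono[of 1 "sqrt (real n)" s]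
    by (auto simp: v_def \<delta>_def real_sqrt_divide power_mult_distrib)
  have "\<bar>g t - g x - g' x * (t - x) - g'' x / 2 * (t - x)\<^sup>2\<bar>
      \<le> ((1 + s / \<delta>) * ((1 + \<delta>\<^sup>2) * (1 + (x + s)\<^sup>2) * W)) * (t - x)\<^sup>2"
    unfolding W_def
    by (rule taylor2_remainder_bound[of "{0..}"])
       (use x t g g' weighted_modulus_bound[OF f \<delta>(1) x] in \<open>auto simp: s_def\<close>)
  also have "\<dots> = (1 + v) * (1 + \<delta>\<^sup>2) * (1 + (x + s)\<^sup>2) * W * (v\<^sup>2 / real n)"
    using v by (simp add: s_def)
  \<comment> \<open>Everything is brought to powers of \<open>1 + v\<close>, using
    \<open>\<delta>\<^sup>2 \<le> 1\<close> and \<open>s \<le> v\<close>; the exponents 1, 2 and 2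
    add up to 5.\<close>
  also have "\<dots> \<le> (1 + v) * 2 * (2 * (1 + x\<^sup>2) * (1 + v)\<^sup>2) * W * ((1 + v)\<^sup>2 / real n)"
  proof -
    have "1 + (x + s)\<^sup>2 \<le> 1 + (x + v)\<^sup>2" using v x s0 by (intro add_left_mono power_mono) auto
    also have "\<dots> \<le> 2 * (1 + x\<^sup>2) * (1 + v)\<^sup>2"
    proof -
      have "(x + v)\<^sup>2 \<le> 2 * x\<^sup>2 + 2 * v\<^sup>2"
        using zero_le_power2[of "x - v"] by (simp add: power2_eq_square algebra_simps)
      moreover have "2 * (1 + x\<^sup>2) * (1 + v)\<^sup>2
          = 2 + 2 * x\<^sup>2 + 2 * v\<^sup>2 + (4 * v + 2 * (x\<^sup>2 * v\<^sup>2) + 4 * (x\<^sup>2 * v))"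
        by (simp add: power2_eq_square algebra_simps)
      moreover have "0 \<le> 4 * v + 2 * (x\<^sup>2 * v\<^sup>2) + 4 * (x\<^sup>2 * v)" using v by simp
      ultimately show ?thesis by linarith
    qed
    finally show ?thesis
      using \<delta> v W by (intro mult_mono divide_right_mono power_mono mult_nonneg_nonneg) auto
  qed
  also have "\<dots> = 4 * (1 + x\<^sup>2) * W / real n * (1 + v) ^ 5"
    by (simp add: power2_eq_square power_numeral_reduce) (simp add: algebra_simps)
  also have "\<dots> \<le> 4 * (1 + x\<^sup>2) * W / real n * (3125 * exp v)"
  proof (rule mult_left_mono)
    \<comment> \<open>The argument is divided by 5 so that the fifth power yields exactly
      \<open>exp v\<close>, with constant 5^5 = 3125.\<close>
    have "1 + v \<le> 5 * exp (v / 5)" using exp_ge_add_one_self[of "v / 5"] by linarith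
    then have "(1 + v) ^ 5 \<le> (5 * exp (v / 5)) ^ 5" using v by (intro power_mono) auto
    also have "\<dots> = 3125 * exp v"
      by (simp add: power_mult_distrib exp_of_nat_mult[symmetric])
    finally show "(1 + v) ^ 5 \<le> 3125 * exp v" .
  qed (use W in auto)
  finally show ?thesis by (simp add: W_def \<delta>_def v_def s_def mult_ac)
qed

section \<open>The quantitative Voronovskaya estimate\<close>

theorem theorem5p1:
  fixes \<alpha> :: "nat \<Rightarrow> real" and g g' g'' :: "real \<Rightarrow> real"
  assumes "\<And>n. n \<ge> 1 \<Longrightarrow> 0 \<le> \<alpha> n \<and> \<alpha> n \<le> 1 / real n"
    and "\<And>t. t \<ge> 0 \<Longrightarrow> (g has_real_derivative g' t) (at t within {0..})"
    and "\<And>t. t \<ge> 0 \<Longrightarrow> (g' has_real_derivative g'' t) (at t within {0..})"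
    and "g' \<in> C_w" and "g'' \<in> C_w"
  shows "\<forall>x\<ge>0. \<exists>C::real. \<exists>n0\<ge>1. \<forall>n\<ge>n0.
           real n * \<bar>U_op n (\<alpha> n) g x - g x - g' x * central_moment n 1 (\<alpha> n) x
                      - g'' x / fact 2 * central_moment n 2 (\<alpha> n) x\<bar>
             \<le> C * weighted_modulus g'' (sqrt (1 / real n))"
proof (intro allI impI)
  fix x :: real assume x: "x \<ge> 0"
  have "real n * \<bar>U_op n (\<alpha> n) g x - g x - g' x * central_moment n 1 (\<alpha> n) x
                      - g'' x / fact 2 * central_moment n 2 (\<alpha> n) x\<bar>
          \<le> 50000 * (1 + x\<^sup>2) * exp (5 * x) * weighted_modulus g'' (sqrt (1 / real n))"
    if n: "n \<ge> 16" for n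
  proof -
    let ?a = "\<alpha> n" and ?W = "weighted_modulus g'' (sqrt (1 / real n))"
    define R where "R t = g t - g x - g' x * (t - x) - g'' x / 2 * (t - x)\<^sup>2" for t
    define K where "K = 12500 * (1 + x\<^sup>2) * ?W / real n"
    define \<theta> where "\<theta> = sqrt (real n)"
    \<comment> \<open>A majorant of \<open>exp (\<theta> * \<bar>t - x\<bar>)\<close> built from the
      two exponentials whose images are already bounded.\<close>
    define G where "G t = exp (\<theta> * (t - x)) + exp (- \<theta> * (t - x))" for t
    have n1: "n \<ge> 1" using n by simp
    have \<alpha>: "0 \<le> ?a" "?a \<le> 1 / real n" using assms(1)[OF n1] by auto
    have W: "?W \<ge> 0" by (simp add: weighted_modulus_nonneg assms(5))
    have K: "K \<ge> 0" using W by (simp add: K_def)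
    have \<theta>: "\<theta>\<^sup>2 = real n" "(- \<theta>)\<^sup>2 = real n" "\<theta> \<ge> 1" using n1 by (auto simp: \<theta>_def)
    note e = U_op_exp_bound[OF n \<alpha> x \<theta>(1)] U_op_exp_bound[OF n \<alpha> x \<theta>(2)]
    have G: "U_dom n ?a x G" "U_op n ?a G x \<le> 4 * exp (5 * x)"
      using U_dom_add[OF e(1) e(3)] e(2,4) by (auto simp: G_def[abs_def])
    have Gge: "exp (\<theta> * \<bar>t - x\<bar>) \<le> G t" for t
      by (cases "t \<ge> x") (auto simp: G_def algebra_simps)
    \<comment> \<open>Growth at most \<open>exp (\<theta> * \<bar>t - x\<bar>)\<close> puts a
      continuous function in the domain; this serves for the powers of \<open>t - x\<close>.\<close>
    have dom: "U_dom n ?a x f" if "continuous_on {0..} f"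
      "\<And>t. \<bar>f t\<bar> \<le> c * exp (\<theta> * \<bar>t - x\<bar>)" "c \<ge> 0" for f c
      by (rule U_dom_dominated(1)[OF \<alpha>(1) x U_dom_cmult(1)[OF G(1), of c] that(1)])
         (use that(2,3) Gge mult_left_mono order_trans in meson)
    have lin: "\<bar>t - x\<bar> \<le> \<theta> * \<bar>t - x\<bar>" for t
      using mult_right_mono[OF \<theta>(3), of "\<bar>t - x\<bar>"] by simp
    have d0: "U_dom n ?a x (\<lambda>_. 1)"
      by (rule dom[of _ 1]) (use \<theta> in auto)
    have d1: "U_dom n ?a x (\<lambda>t. (t - x) ^ 1)"
    proof (rule dom[of _ 1])
      fix t
      show "\<bar>(t - x) ^ 1\<bar> \<le> 1 * exp (\<theta> * \<bar>t - x\<bar>)"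
        unfolding power_one_right mult_1
        using lin[of t] exp_ge_add_one_self[of "\<theta> * \<bar>t - x\<bar>"] by linarith
    qed (auto intro!: continuous_intros)
    have d2: "U_dom n ?a x (\<lambda>t. (t - x) ^ 2)"
    proof (rule dom[of _ 2])
      fix t
      \<comment> \<open>The constant 2 comes from \<open>1 + s + s\<^sup>2 / 2 \<le> exp s\<close>
        for \<open>s \<ge> 0\<close>.\<close>
      have "(t - x)\<^sup>2 \<le> (\<theta> * \<bar>t - x\<bar>)\<^sup>2"
        using power_mono[OF lin[of t], of 2] by simp
      moreover have nn: "0 \<le> \<theta> * \<bar>t - x\<bar>" using \<theta>(3) by simp
      ultimately show "\<bar>(t - x) ^ 2\<bar> \<le> 2 * exp (\<theta> * \<bar>t - x\<bar>)"
        using exp_lower_Taylor_quadratic[OF nn] unfolding abs_power2 by linarith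
    qed (auto intro!: continuous_intros)
    have "continuous_on {0..} g"
      using assms(2) by (auto intro!: DERIV_continuous_on)
    then have Rc: "continuous_on {0..} R"
      unfolding R_def by (intro continuous_intros)
    have Rb: "\<bar>R t\<bar> \<le> K * G t" if "t \<ge> 0" for t
    proof -
      have "\<bar>R t\<bar> \<le> K * exp (\<theta> * \<bar>t - x\<bar>)"
        unfolding R_def K_def \<theta>_def
        by (rule taylor2_remainder_exp_bound[OF assms(2,3,5) n1 x that])
      also have "\<dots> \<le> K * G t" by (intro mult_left_mono Gge K)
      finally show ?thesis .
    qed
    have R: "U_dom n ?a x R" "\<bar>U_op n ?a R x\<bar> \<le> U_op n ?a (\<lambda>t. K * G t) x"
      using U_dom_dominated[OF \<alpha>(1) x U_dom_cmult(1)[OF G(1)] Rc] Rb by blast+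
    note c = U_dom_cmult[OF d0, of "g x"] U_dom_cmult[OF d1, of "g' x"]
      U_dom_cmult[OF d2, of "g'' x / 2"]
    note s2 = U_dom_add[OF c(3) c(5)]
    note s1 = U_dom_add[OF c(1) s2(1)]
    \<comment> \<open>Convergence for \<open>g\<close> comes from its pieces: the remainder and the
      three monomials all lie in the domain.\<close>
    have "g = (\<lambda>t. R t + (g x * 1 + (g' x * (t - x) ^ 1 + g'' x / 2 * (t - x) ^ 2)))"
      by (simp add: R_def)
    then have "U_op n ?a g x = U_op n ?a (\<lambda>t. R t + (g x * 1 + (g' x * (t - x) ^ 1 + g'' x / 2 * (t - x) ^ 2))) x"
      by (rule arg_cong)
    also have "\<dots> = U_op n ?a R x + (g x + (g' x * central_moment n 1 ?a x
                        + g'' x / 2 * central_moment n 2 ?a x))"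
      unfolding central_moment_def U_dom_add(2)[OF R(1) s1(1)] s1(2) s2(2) c(2,4,6)
        U_op_1[OF n1 \<alpha>] by simp
    finally have "real n * \<bar>U_op n ?a g x - g x - g' x * central_moment n 1 ?a x
                      - g'' x / fact 2 * central_moment n 2 ?a x\<bar> = real n * \<bar>U_op n ?a R x\<bar>"
      by simp
    also have "\<dots> \<le> real n * (K * (4 * exp (5 * x)))"
      using R(2) mult_left_mono[OF G(2) K] U_dom_cmult(2)[OF G(1), of K]
      by (intro mult_left_mono) auto
    \<comment> \<open>The factor \<open>1 / n\<close> inside \<open>K\<close> cancels the leading
      \<open>n\<close>, and 4 * 12500 = 50000.\<close>
    also have "\<dots> = 50000 * (1 + x\<^sup>2) * exp (5 * x) * ?W"
      using n1 by (simp add: K_def)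
    finally show ?thesis .
  qed
  then show "\<exists>C::real. \<exists>n0\<ge>1. \<forall>n\<ge>n0.
           real n * \<bar>U_op n (\<alpha> n) g x - g x - g' x * central_moment n 1 (\<alpha> n) x
                      - g'' x / fact 2 * central_moment n 2 (\<alpha> n) x\<bar>
             \<le> C * weighted_modulus g'' (sqrt (1 / real n))"
    by (intro exI[of _ "50000 * (1 + x\<^sup>2) * exp (5 * x)"] exI[of _ 16]) auto
qed

end
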